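(* Let $A$ and $B$ be solutions. Then the composition $A\otimes B$ is a solution if and only if both of the following conditions hold: 1. $\{B(i)-i \pmod{|B|} \mid 1\le i\le |B|\}=\mathbb{Z}_{|B|}$; 2. $\{B(i)+i \pmod{|B|} \mid 1\le i\le |B|\}=\mathbb{Z}_{|B|}$.
   Context: A solution of size $N$ (to the $N$-Queens Problem) is a permutation $A$ of $\{1,\dots,N\}$ such that $|i-j|\neq|A(i)-A(j)|$ for all $1\le i<j\le N$; its size is denoted $|A|=N$. The composition $A\otimes B$ of arbitrary solutions $A$ and $B$ is the arrangement obtained by inserting a copy of the board $B$ at each queen position of $A$; explicitly it is the map $C$ on $\{1,\dots,|A||B|\}$ given by $$C(|B|(i-1)+j)=|B|(A(i)-1)+B(j),\qquad 1\le i\le |A|,\ 1\le j\le |B|.$$ $\mathbb{Z}_{|B|}$ denotes the ring of residues modulo $|B|$.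
   Formalization: The formal theorem assumes |A| ≠ 1 (and non-empty boards): for |A| = 1 the composition is B itself, always a solution, but condition 1 can fail, e.g. B = (2,4,1,3), where B(i)-i mod 4 gives 1,2,2,3. *)

theory Defs
  imports "HOL-Combinatorics.Permutations" "HOL-Number_Theory.Residues"
begin

text \<open>Library permutations of \<open>{1..N}\<close> are total functions that are the identity outside
  \<open>{1..N}\<close>. Distances are taken in the integers because natural subtraction truncates.
  The board is nonempty.\<close>

definition queens_solution :: "nat \<Rightarrow> (nat \<Rightarrow> nat) \<Rightarrow> bool" where
  "queens_solution N A \<longleftrightarrow> 0 < N \<and> A permutes {1..N} \<and>
     (\<forall>i j. 1 \<le> i \<and> i < j \<and> j \<le> N \<longrightarrow>
        \<bar>int i - int j\<bar> \<noteq> \<bar>int (A i) - int (A j)\<bar>)"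

text \<open>A position \<open>k\<close> in \<open>{1..N * n}\<close> is written uniquely as \<open>n * (i - 1) + j\<close> with
  \<open>i = (k - 1) div n + 1\<close> and \<open>j = (k - 1) mod n + 1\<close>.\<close>

definition queens_comp :: "nat \<Rightarrow> (nat \<Rightarrow> nat) \<Rightarrow> nat \<Rightarrow> (nat \<Rightarrow> nat) \<Rightarrow> nat \<Rightarrow> nat" where
  "queens_comp N A n B k =
     (if k \<in> {1..N * n}
      then n * (A ((k - 1) div n + 1) - 1) + B ((k - 1) mod n + 1)
      else k)"

lemma queens_comp_eq:
  assumes "1 \<le> i" "i \<le> N" "1 \<le> j" "j \<le> n"
  shows "queens_comp N A n B (n * (i - 1) + j) = n * (A i - 1) + B j"
proof -
  obtain a b where ab: "i = Suc a" "j = Suc b"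
    using assms by (metis Suc_le_D One_nat_def)
  then have lt: "a < N" "b < n" using assms by auto
  have "n * Suc a \<le> n * N" using lt by (intro mult_le_mono2) simp
  then have "n * a + Suc b \<le> N * n" using lt by (simp add: mult.commute)
  then show ?thesis using ab lt by (simp add: queens_comp_def)
qed

text \<open>For \<open>N = 1\<close> the composition is \<open>B\<close> itself, hence always a solution, although \<open>B\<close> need
  not have distinct diagonals modulo \<open>n\<close> (for example 2, 4, 1, 3 with \<open>n = 4\<close>). A criterion for
  the composition in terms of the diagonals of \<open>B\<close> modulo \<open>n\<close> therefore needs \<open>N \<noteq> 1\<close>.\<close>

end

theory Submission
  imports Defs
begin

text \<open>
  Number the diagonals of one direction by \<open>A i - i\<close> and those of the other by \<open>A i + i\<close>; a
  permutation is a solution iff it is injective on both kinds of diagonal. The queen of \<open>A \<otimes> B\<close>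
  that sits at place \<open>j\<close> in the \<open>i\<close>-th copy of \<open>B\<close> has, up to a constant, the diagonal number
  \<open>n * a + b\<close>, where \<open>a\<close> is the diagonal of \<open>i\<close> in \<open>A\<close> and \<open>b\<close> the diagonal of \<open>j\<close> in \<open>B\<close>
  (\<open>diagonal_comp\<close>).

  If the diagonals of \<open>B\<close> are distinct modulo \<open>n\<close>, the number \<open>n * a + b\<close> determines \<open>j\<close>, then
  \<open>a\<close>, and then \<open>i\<close> because \<open>A\<close> is a solution. Conversely, suppose that two diagonals of \<open>B\<close> are
  congruent modulo \<open>n\<close>. They are distinct and less than \<open>2 * n\<close> apart, so they differ by exactly
  \<open>n\<close>. This clash becomes an attack in \<open>A \<otimes> B\<close> once \<open>A\<close> has two queens on neighbouring
  diagonals, to compensate the difference \<open>n\<close>.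

  Such queens exist when \<open>N > 1\<close> (\<open>neighbouring_diagonals\<close>). There are \<open>2 * N - 1\<close> diagonals and
  \<open>N\<close> occupied ones, so if no two occupied ones were neighbours, every other diagonal would be
  occupied, including the first and the last. Those two consist of one corner square each, and
  queens in two opposite corners attack each other along the other direction.

  Finally, \<open>n\<close> residues are distinct iff they exhaust the \<open>n\<close> residue classes, which turns
  distinctness modulo \<open>n\<close> into the two conditions of the theorem.
\<close>

section \<open>Solutions and diagonals\<close>

text \<open>The sign \<open>s\<close>, always \<open>1\<close> or \<open>-1\<close>, selects the direction, so that both directions share
  one proof.\<close>

definition diagonal :: "int \<Rightarrow> (nat \<Rightarrow> nat) \<Rightarrow> nat \<Rightarrow> int" where
  "diagonal s A i = int (A i) - s * int i"

lemma queens_solution_iff_diagonals: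
  "queens_solution N A \<longleftrightarrow>
     0 < N \<and> A permutes {1..N} \<and> (\<forall>s\<in>{1, -1}. inj_on (diagonal s A) {1..N})"
proof -
  have "(\<forall>i j. 1 \<le> i \<and> i < j \<and> j \<le> N \<longrightarrow>
          \<bar>int i - int j\<bar> \<noteq> \<bar>int (A i) - int (A j)\<bar>) \<longleftrightarrow>
        (\<forall>s\<in>{1, -1}. inj_on (diagonal s A) {1..N})" (is "?L \<longleftrightarrow> ?R")
  proof
    assume L: ?L
    have "i = j" if "i \<in> {1..N}" "j \<in> {1..N}" "s \<in> {1, -1}" "diagonal s A i = diagonal s A j"
      for i j s
    proof -
      have "\<bar>int i - int j\<bar> = \<bar>int (A i) - int (A j)\<bar>"
        using that(3,4) by (auto simp: diagonal_def abs_if split: if_splits)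
      moreover have "\<bar>int j - int i\<bar> = \<bar>int (A j) - int (A i)\<bar>"
        using calculation by linarith
      ultimately show ?thesis
        using L that(1,2) by (metis atLeastAtMost_iff linorder_neqE_nat)
    qed
    then show ?R unfolding inj_on_def by blast
  next
    assume R: ?R
    show ?L
    proof (intro allI impI notI)
      fix i j
      assume ij: "1 \<le> i \<and> i < j \<and> j \<le> N"
        and "\<bar>int i - int j\<bar> = \<bar>int (A i) - int (A j)\<bar>"
      then have "diagonal 1 A i = diagonal 1 A j \<or> diagonal (-1) A i = diagonal (-1) A j"
        by (auto simp: diagonal_def abs_if split: if_splits)
      then show False
        using R ij by (auto dest!: inj_onD)
    qed
  qed
  then show ?thesis unfolding queens_solution_def by blast
qed

lemma queens_solutionD:
  assumes "queens_solution N A"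
  shows "0 < N" "A permutes {1..N}" "s \<in> {1, -1} \<Longrightarrow> inj_on (diagonal s A) {1..N}"
    "i \<in> {1..N} \<Longrightarrow> A i \<in> {1..N}"
  using assms unfolding queens_solution_iff_diagonals by (auto dest: permutes_in_image)

section \<open>Neighbouring diagonals\<close>

text \<open>Pigeonhole principle, with the \<open>m\<close> dominoes \<open>{lo + 2 * k, lo + 2 * k + 1}\<close> as holes.\<close>

lemma exists_consecutive:
  fixes S :: "int set"
  assumes "S \<subseteq> {lo..<lo + 2 * int m}" and "m < card S"
  shows "\<exists>x\<in>S. x + 1 \<in> S"
proof -
  let ?h = "\<lambda>x. (x - lo) div 2"
  have "?h x \<in> {0..<int m}" if "x \<in> S" for x
  proof -
    have "lo \<le> x \<and> x < lo + 2 * int m" using assms(1) that by auto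
    then show ?thesis by auto
  qed
  then have "?h ` S \<subseteq> {0..<int m}" by blast
  then have "card (?h ` S) \<le> m"
    using card_mono[of "{0..<int m}"] by fastforce
  then have "\<not> inj_on ?h S"
    using assms(2) card_image[of ?h S] by auto
  then obtain x y where "x \<in> S" "y \<in> S" "x \<noteq> y" "?h x = ?h y"
    unfolding inj_on_def by blast
  moreover from this have "y = x + 1 \<or> x = y + 1" by presburger
  ultimately show ?thesis by auto
qed

lemma neighbouring_diagonals:
  assumes A: "queens_solution N A" and "N \<noteq> 1" and s: "s \<in> {1, -1}"
  shows "\<exists>i\<in>{1..N}. \<exists>i'\<in>{1..N}. diagonal s A i' = diagonal s A i + 1"
proof (rule ccontr)
  assume none: "\<not> ?thesis"
  let ?S = "diagonal s A ` {1..N}"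
  have N: "1 < N" using queens_solutionD(1)[OF A] assms(2) by simp
  have range: "A i \<in> {1..N}" if "i \<in> {1..N}" for i
    using queens_solutionD(4)[OF A that] .
  have "card ?S = N"
    using card_image[OF queens_solutionD(3)[OF A s]] by simp
  then have "N - 1 < card ?S" using N by simp
  moreover have "\<not> (\<exists>x\<in>?S. x + 1 \<in> ?S)" using none by (metis imageE)
  ultimately have gap: "\<not> ?S \<subseteq> {lo..<lo + 2 * int (N - 1)}" for lo
    using exists_consecutive by blast
  \<comment> \<open>the number of the first diagonal: \<open>1 - N\<close> or \<open>2\<close>\<close>
  define lo where "lo = (if s = 1 then 1 - int N else 2)"
  have bounds: "lo \<le> diagonal s A i \<and> diagonal s A i \<le> lo + 2 * int (N - 1)"
    if "i \<in> {1..N}" for i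
  proof -
    have "1 \<le> i \<and> i \<le> N \<and> 1 \<le> A i \<and> A i \<le> N" using range[OF that] that by simp
    then show ?thesis using s by (auto simp: lo_def diagonal_def)
  qed
  obtain p where p: "p \<in> {1..N}" "diagonal s A p = lo + 2 * int (N - 1)"
  proof -
    obtain p where "p \<in> {1..N}" "diagonal s A p \<notin> {lo..<lo + 2 * int (N - 1)}"
      using gap[of lo] by blast
    then show ?thesis using that[of p] bounds[of p] by simp
  qed
  obtain q where q: "q \<in> {1..N}" "diagonal s A q = lo"
  proof -
    obtain q where "q \<in> {1..N}" "diagonal s A q \<notin> {lo + 1..<lo + 1 + 2 * int (N - 1)}"
      using gap[of "lo + 1"] by blast
    then show ?thesis using that[of q] bounds[of q] by simp
  qed
  \<comment> \<open>the queens \<open>p\<close> and \<open>q\<close> occupy opposite corners\<close>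
  have "diagonal (- s) A p = diagonal (- s) A q \<and> p \<noteq> q"
  proof -
    have "1 \<le> p \<and> p \<le> N \<and> 1 \<le> A p \<and> A p \<le> N" "1 \<le> q \<and> q \<le> N \<and> 1 \<le> A q \<and> A q \<le> N"
      using p(1) q(1) range[OF p(1)] range[OF q(1)] by simp_all
    then show ?thesis
      using p(2) q(2) s N by (auto simp: lo_def diagonal_def of_nat_diff)
  qed
  moreover have "inj_on (diagonal (- s) A) {1..N}"
    using queens_solutionD(3)[OF A, of "- s"] s by auto
  ultimately show False
    using p(1) q(1) by (auto dest: inj_onD)
qed

section \<open>Coordinates on the composed board\<close>

lemma block_coordinates:
  fixes k n N :: nat
  assumes "k \<in> {1..N * n}"
  obtains i j where "i \<in> {1..N}" "j \<in> {1..n}" "k = n * (i - 1) + j"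
proof
  have n: "0 < n" using assms by (cases n) auto
  have "k - 1 < N * n" using assms by auto
  then have "(k - 1) div n < N" by (simp add: less_mult_imp_div_less)
  then show "(k - 1) div n + 1 \<in> {1..N}" by auto
  show "(k - 1) mod n + 1 \<in> {1..n}" using n by (simp add: Suc_leI)
  show "k = n * ((k - 1) div n + 1 - 1) + ((k - 1) mod n + 1)"
    using assms by simp
qed

lemma block_coordinates_in_range:
  fixes i j n N :: nat
  assumes "i \<in> {1..N}" "j \<in> {1..n}"
  shows "n * (i - 1) + j \<in> {1..N * n}"
proof -
  have "n * (i - 1) + n = n * i" using assms(1) by (cases i) auto
  also have "\<dots> \<le> N * n" using assms(1) by (simp add: mult.commute)
  finally show ?thesis using assms(2) by auto
qed

lemma block_coordinates_unique:
  fixes i j n :: nat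
  assumes "n * (i - 1) + j = n * (i' - 1) + j'"
    and "1 \<le> i" "1 \<le> i'" and "j \<in> {1..n}" "j' \<in> {1..n}"
  shows "i = i' \<and> j = j'"
proof -
  have eq: "n * (i - 1) + (j - 1) = n * (i' - 1) + (j' - 1)" "j - 1 < n" "j' - 1 < n"
    using assms by auto
  have "(n * (i - 1) + (j - 1)) div n = i - 1" "(n * (i' - 1) + (j' - 1)) div n = i' - 1"
    using eq(2,3) by auto
  then have "i - 1 = i' - 1" using eq(1) by simp
  then show ?thesis using assms by auto
qed

lemma queens_comp_coordinates:
  assumes "i \<in> {1..N}" "j \<in> {1..n}"
  shows "queens_comp N A n B (n * (i - 1) + j) = n * (A i - 1) + B j"
  using queens_comp_eq assms by auto

lemma queens_comp_permutes:
  assumes A: "A permutes {1..N}" and B: "B permutes {1..n}"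
  shows "queens_comp N A n B permutes {1..N * n}"
proof (rule bij_imp_permutes)
  let ?C = "queens_comp N A n B"
  have A_in: "A i \<in> {1..N}" if "i \<in> {1..N}" for i
    using permutes_in_image[OF A] that by blast
  have B_in: "B j \<in> {1..n}" if "j \<in> {1..n}" for j
    using permutes_in_image[OF B] that by blast
  have "?C ` {1..N * n} \<subseteq> {1..N * n}"
  proof
    fix c assume "c \<in> ?C ` {1..N * n}"
    then obtain k where k: "k \<in> {1..N * n}" "c = ?C k" by blast
    obtain i j where "i \<in> {1..N}" "j \<in> {1..n}" "k = n * (i - 1) + j"
      using k(1) by (rule block_coordinates)
    then show "c \<in> {1..N * n}"
      using k(2) block_coordinates_in_range A_in B_in
      by (simp only: queens_comp_coordinates)
  qed
  moreover have "inj_on ?C {1..N * n}"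
  proof (rule inj_onI)
    fix k k' assume k: "k \<in> {1..N * n}" and k': "k' \<in> {1..N * n}" and eq: "?C k = ?C k'"
    obtain i j where ij: "i \<in> {1..N}" "j \<in> {1..n}" "k = n * (i - 1) + j"
      using k by (rule block_coordinates)
    obtain i' j' where ij': "i' \<in> {1..N}" "j' \<in> {1..n}" "k' = n * (i' - 1) + j'"
      using k' by (rule block_coordinates)
    have "n * (A i - 1) + B j = n * (A i' - 1) + B j'"
      using eq ij ij' by (simp only: queens_comp_coordinates)
    then have "A i = A i' \<and> B j = B j'"
      using A_in[OF ij(1)] A_in[OF ij'(1)] B_in[OF ij(2)] B_in[OF ij'(2)]
      by (intro block_coordinates_unique) auto
    then show "k = k'"
      using ij(3) ij'(3) permutes_inj[OF A] permutes_inj[OF B] by (simp add: inj_eq)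
  qed
  ultimately show "bij_betw ?C {1..N * n} {1..N * n}"
    by (simp add: bij_betw_def endo_inj_surj)
  show "?C k = k" if "k \<notin> {1..N * n}" for k
    using that unfolding queens_comp_def by (rule if_not_P)
qed

section \<open>Diagonals of the composition\<close>

lemma diagonal_comp:
  assumes "i \<in> {1..N}" "j \<in> {1..n}" "1 \<le> A i"
  shows "diagonal s (queens_comp N A n B) (n * (i - 1) + j) =
    int n * (diagonal s A i + s - 1) + diagonal s B j"
proof -
  have pos: "int (n * (i - 1) + j) = int n * (int i - 1) + int j"
    and val: "int (n * (A i - 1) + B j) = int n * (int (A i) - 1) + int (B j)"
    using assms(1,3) by (auto simp: of_nat_diff)
  then show ?thesis
    unfolding diagonal_def queens_comp_coordinates[OF assms(1,2)] pos val
    by (simp add: algebra_simps)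
qed

lemma inj_on_diagonal_comp_iff:
  assumes A: "queens_solution N A" and B: "queens_solution n B"
    and N: "N \<noteq> 1" and s: "s \<in> {1, -1}"
  shows "inj_on (diagonal s (queens_comp N A n B)) {1..N * n} \<longleftrightarrow>
    inj_on (\<lambda>j. diagonal s B j mod int n) {1..n}"
    (is "inj_on ?D _ \<longleftrightarrow> inj_on ?R _")
proof
  have D: "?D (n * (i - 1) + j) = int n * (diagonal s A i + s - 1) + diagonal s B j"
    if "i \<in> {1..N}" "j \<in> {1..n}" for i j
    using diagonal_comp that queens_solutionD(4)[OF A that(1)] by auto
  show "inj_on ?D {1..N * n}" if R: "inj_on ?R {1..n}"
  proof (rule inj_onI)
    fix k k' assume k: "k \<in> {1..N * n}" and k': "k' \<in> {1..N * n}" and eq: "?D k = ?D k'"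
    obtain i j where ij: "i \<in> {1..N}" "j \<in> {1..n}" "k = n * (i - 1) + j"
      using k by (rule block_coordinates)
    obtain i' j' where ij': "i' \<in> {1..N}" "j' \<in> {1..n}" "k' = n * (i' - 1) + j'"
      using k' by (rule block_coordinates)
    have sum: "int n * (diagonal s A i + s - 1) + diagonal s B j =
        int n * (diagonal s A i' + s - 1) + diagonal s B j'"
      using eq ij ij' by (simp only: D)
    then have "?R j = ?R j'"
      by (metis mod_mult_self4)
    then have j: "j = j'" using R ij(2) ij'(2) by (auto dest: inj_onD)
    then have "diagonal s A i = diagonal s A i'"
      using sum queens_solutionD(1)[OF B] by simp
    then have "i = i'"
      using queens_solutionD(3)[OF A s] ij(1) ij'(1) by (auto dest: inj_onD)
    then show "k = k'" using j ij(3) ij'(3) by simp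
  qed
  show "inj_on ?R {1..n}" if inj: "inj_on ?D {1..N * n}"
  proof (rule ccontr)
    assume "\<not> inj_on ?R {1..n}"
    then obtain j k where jk: "j \<in> {1..n}" "k \<in> {1..n}" "j \<noteq> k" "?R j = ?R k"
      unfolding inj_on_def by blast
    then have "int n dvd diagonal s B j - diagonal s B k"
      by (simp add: mod_eq_dvd_iff)
    then obtain t where t: "diagonal s B j - diagonal s B k = int n * t" ..
    have "diagonal s B j \<noteq> diagonal s B k"
      using queens_solutionD(3)[OF B s] jk(1-3) by (auto dest: inj_onD)
    then have "t \<noteq> 0" using t by auto
    have "\<bar>diagonal s B j - diagonal s B k\<bar> < int n * 2"
      using queens_solutionD(4)[OF B jk(1)] queens_solutionD(4)[OF B jk(2)] jk(1,2) s
      by (auto simp: diagonal_def)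
    then have "int n * \<bar>t\<bar> < int n * 2"
      using t by (simp add: abs_mult)
    then have "\<bar>t\<bar> < 2" by (simp add: mult_less_cancel_left)
    then have "t = 1 \<or> t = -1" using \<open>t \<noteq> 0\<close> by linarith
    have "\<exists>p\<in>{1..n}. \<exists>q\<in>{1..n}. p \<noteq> q \<and> diagonal s B p = diagonal s B q + int n"
    proof (cases "t = 1")
      case True
      then have "diagonal s B j = diagonal s B k + int n" using t by simp
      then show ?thesis using jk(1-3) by blast
    next
      case False
      then have "t = -1" using \<open>t = 1 \<or> t = -1\<close> by simp
      then have "diagonal s B k = diagonal s B j + int n" using t by simp
      then show ?thesis using jk(1-3) by metis
    qed
    then obtain p q where pq: "p \<in> {1..n}" "q \<in> {1..n}" "p \<noteq> q"
        "diagonal s B p = diagonal s B q + int n"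
      by blast
    obtain i i' where i: "i \<in> {1..N}" "i' \<in> {1..N}" "diagonal s A i' = diagonal s A i + 1"
      using neighbouring_diagonals[OF A N s] by blast
    have "?D (n * (i - 1) + p) = ?D (n * (i' - 1) + q)"
      unfolding D[OF i(1) pq(1)] D[OF i(2) pq(2)] i(3) pq(4) by (simp add: algebra_simps)
    then have "n * (i - 1) + p = n * (i' - 1) + q"
      using inj_onD[OF inj] block_coordinates_in_range i(1,2) pq(1,2) by blast
    then show False
      using block_coordinates_unique[of n i p i' q] i(1,2) pq(1-3) by auto
  qed
qed

lemma residues_exhaust_iff_inj:
  fixes f :: "nat \<Rightarrow> int"
  assumes "0 < n"
  shows "{f i mod int n | i. 1 \<le> i \<and> i \<le> n} = carrier (residue_ring (int n)) \<longleftrightarrow>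
    inj_on (\<lambda>i. f i mod int n) {1..n}"
    (is "?S = _ \<longleftrightarrow> inj_on ?g _")
proof -
  have S: "?S = ?g ` {1..n}" by auto
  have C: "carrier (residue_ring (int n)) = {0..<int n}"
    by (auto simp: residue_ring_def)
  have sub: "?g ` {1..n} \<subseteq> {0..<int n}" using assms by auto
  have "?g ` {1..n} = {0..<int n} \<longleftrightarrow> card (?g ` {1..n}) = n"
    using card_subset_eq[OF _ sub] by auto
  also have "\<dots> \<longleftrightarrow> inj_on ?g {1..n}"
    using inj_on_iff_eq_card[of "{1..n}" ?g] by simp
  finally show ?thesis unfolding S C .
qed

theorem mainTheorem3:
  fixes N n :: nat and A B :: "nat \<Rightarrow> nat"
  assumes "queens_solution N A" and "queens_solution n B"
    and "N \<noteq> 1"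
  shows "queens_solution (N * n) (queens_comp N A n B) \<longleftrightarrow>
    {(int (B i) - int i) mod int n | i. 1 \<le> i \<and> i \<le> n} = carrier (residue_ring (int n)) \<and>
    {(int (B i) + int i) mod int n | i. 1 \<le> i \<and> i \<le> n} = carrier (residue_ring (int n))"
proof -
  have n: "0 < n" and "0 < N * n"
    using queens_solutionD(1) assms(1,2) by auto
  moreover have "queens_comp N A n B permutes {1..N * n}"
    using queens_comp_permutes queens_solutionD(2) assms(1,2) by blast
  ultimately have "queens_solution (N * n) (queens_comp N A n B) \<longleftrightarrow>
      (\<forall>s\<in>{1, -1}. inj_on (\<lambda>j. diagonal s B j mod int n) {1..n})"
    unfolding queens_solution_iff_diagonals
    using inj_on_diagonal_comp_iff[OF assms] by blast
  then show ?thesis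
    unfolding residues_exhaust_iff_inj[OF n] by (simp add: diagonal_def)
qed

end
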